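(* Let $m \geq 5$ be an integer with $m \notin \{6, 9\}$. Then $m$ is prime if and only if $m$ does not divide $4(m-5)!$, i.e. $4(m-5)! \not\equiv 0 \pmod{m}$. Moreover, the equivalence fails for $m=6$ and for $m=9$: each of these satisfies $4(m-5)! \not\equiv 0 \pmod m$ without being prime. *)

theory Defs
  imports "HOL-Number_Theory.Cong"
begin

end

theory Submission
  imports Defs
begin

text \<open>A composite \<open>m \<ge> 10\<close> already divides \<open>(m - 5)!\<close>: if \<open>m = a b\<close> with \<open>2 \<le> a < b\<close>, then \<open>a\<close> and
  \<open>b\<close> are distinct factors of the product \<open>(m - 5)!\<close>, and if \<open>m = a\<^sup>2\<close>, then \<open>a\<close> and \<open>2 a\<close> are. The factor 4 is
  needed only for \<open>m = 8\<close>.\<close>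

lemma mult_dvd_fact:
  fixes a b n :: nat
  assumes "0 < a" "a < b" "b \<le> n"
  shows "a * b dvd fact n"
proof -
  have "\<Prod>{a, b} dvd \<Prod>{1..n}"
    by (rule prod_dvd_prod_subset) (use assms in auto)
  then show ?thesis
    using assms by (simp add: fact_prod)
qed

lemma composite_dvd_fact_diff_5:
  fixes m :: nat
  assumes "10 \<le> m" "\<not> prime m"
  shows "m dvd fact (m - 5)"
proof -
  obtain c where "c dvd m" "c \<noteq> 1" "c \<noteq> m"
    using assms by (auto simp: prime_nat_iff)
  then obtain d where "m = c * d"
    by blast
  with \<open>c \<noteq> 1\<close> \<open>c \<noteq> m\<close> assms(1) have "2 \<le> c" "2 \<le> d"
    by (cases c; cases d; fastforce)+
  \<comment> \<open>Sorting the cofactors makes unequal ones satisfy \<open>a < b\<close>, as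
    \<open>mult_dvd_fact\<close> requires.\<close>
  define a b where "a = min c d" and "b = max c d"
  have m: "m = a * b" and "2 \<le> a" "a \<le> b"
    using \<open>m = c * d\<close> \<open>2 \<le> c\<close> \<open>2 \<le> d\<close> by (auto simp: a_def b_def min_def max_def)
  show ?thesis
  proof (cases "a = b")
    case False
    have "2 * b \<le> m"
      using m \<open>2 \<le> a\<close> by simp
    \<comment> \<open>Half of \<open>m\<close> is at most \<open>m - 5\<close> exactly when
      \<open>10 \<le> m\<close>.\<close>
    then have "b \<le> m - 5"
      using assms(1) by linarith
    then have "a * b dvd fact (m - 5)"
      using False \<open>2 \<le> a\<close> \<open>a \<le> b\<close> by (intro mult_dvd_fact) auto
    then show ?thesis
      using m by simp
  next
    case True
    have "4 \<le> a"
    proof (rule ccontr)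
      assume "\<not> 4 \<le> a"
      then have "a * a \<le> 3 * 3"
        by (intro mult_le_mono) auto
      then show False
        using assms(1) m True by simp
    qed
    \<comment> \<open>Hence \<open>2 * a\<close> is at most half of \<open>m\<close>, so again at
      most \<open>m - 5\<close>.\<close>
    then have "4 * a \<le> m"
      using m True by simp
    then have "a * (2 * a) dvd fact (m - 5)"
      using \<open>4 \<le> a\<close> by (intro mult_dvd_fact) auto
    moreover have "m dvd a * (2 * a)"
      using m True by simp
    ultimately show ?thesis
      by (rule dvd_trans[rotated])
  qed
qed

lemma prime_iff_not_dvd_4_fact:
  fixes m :: nat
  assumes "5 \<le> m" "m \<notin> {6, 9}"
  shows "prime m \<longleftrightarrow> \<not> m dvd 4 * fact (m - 5)"
proof
  assume "prime m"
  moreover have "\<not> m dvd 4"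
    using assms(1) by (auto dest: dvd_imp_le)
  \<comment> \<open>A prime divides \<open>fact n\<close> only if it is at most \<open>n\<close>,
    and \<open>m\<close> exceeds \<open>m - 5\<close>.\<close>
  ultimately show "\<not> m dvd 4 * fact (m - 5)"
    using assms(1) by (auto simp: prime_dvd_mult_iff prime_dvd_fact_iff)
next
  assume *: "\<not> m dvd 4 * fact (m - 5)"
  show "prime m"
  proof (rule ccontr)
    assume "\<not> prime m"
    then have "m < 10"
      using * composite_dvd_fact_diff_5[of m] by (meson dvd_mult not_le)
    \<comment> \<open>Of these, 5 and 7 are prime, while 8 divides \<open>4 * fact 3\<close>, which
      is 24.\<close>
    then have "m \<in> {5, 7, 8}"
      using assms by auto
    moreover have "prime (5::nat)" "prime (7::nat)"
      by simp_all
    ultimately show False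
      using * \<open>\<not> prime m\<close> by (auto simp: fact_numeral)
  qed
qed

theorem theorem1:
  shows "(\<forall>m::nat. m \<ge> 5 \<and> m \<notin> {6, 9} \<longrightarrow>
            (prime m \<longleftrightarrow> \<not> m dvd 4 * fact (m - 5)) \<and>
            (prime m \<longleftrightarrow> \<not> [4 * fact (m - 5) = 0] (mod m)))
       \<and> (\<forall>m\<in>{6, 9::nat}. \<not> [4 * fact (m - 5) = 0] (mod m) \<and> \<not> prime m)"
proof -
  have "\<not> prime (6::nat)" "\<not> prime (9::nat)"
    by simp_all
  \<comment> \<open>The exceptions are computed: \<open>4 * fact 1\<close> is 4, not divisible by 6,
    and \<open>4 * fact 4\<close> is 96, which leaves remainder 6 modulo 9.\<close>
  then show ?thesis
    using prime_iff_not_dvd_4_fact by (auto simp: cong_0_iff fact_numeral)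
qed

end
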